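(* If $k\in \mathbb{N}$ (a positive integer), then the hypercube $Q_{2^k}$ is a perfect injectively colorable graph.
   Context: Hypercubes are defined by $Q_1=K_2$ and $Q_n=Q_{n-1}\,\Box\, K_2$ for $n\ge 2$, where $\Box$ is the Cartesian product of graphs (two vertices of $G\,\Box\,H$ are adjacent if they are adjacent in one coordinate and equal in the other). An injective coloring of a finite simple graph $G$ is a partition of $V(G)$ into color classes of a function $f$ on $V(G)$ such that no vertex is adjacent to two distinct vertices $u,w$ with $f(u)=f(w)$. An open packing in $G$ is a set $B\subseteq V(G)$ such that $N_G(u)\cap N_G(v)=\emptyset$ for any two distinct $u,v\in B$. The open packing number $\rho^{\rm o}(G)$ is the maximum cardinality of an open packing in $G$. $G$ is a perfect injectively colorable graph if it has an injective coloring in which every color class is an open packing of cardinality $\rho^{\rm o}(G)$. *)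

theory Defs
  imports "Graph_Theory.Pair_Digraph"
begin

text \<open>
  Finite simple graphs are the digraphs satisfying the library locale predicate
  \<^const>\<open>pair_graph\<close> (finite, symmetric, loop-free, no parallel arcs); an edge
  \<open>uv\<close> is represented by the two arcs \<open>(u, v)\<close> and \<open>(v, u)\<close>.
\<close>

definition cartesian_product_graph ::
    "'a pair_pre_digraph \<Rightarrow> 'b pair_pre_digraph \<Rightarrow> ('a \<times> 'b) pair_pre_digraph" where
  "cartesian_product_graph G H =
    \<lparr> pverts = pverts G \<times> pverts H,
      parcs = {((g, h), (g', h')) | g h g' h'.
        ((g, g') \<in> parcs G \<and> h = h' \<and> h \<in> pverts H) \<or>
        (g = g' \<and> g \<in> pverts G \<and> (h, h') \<in> parcs H)} \<rparr>"

definition map_graph :: "('a \<Rightarrow> 'b) \<Rightarrow> 'a pair_pre_digraph \<Rightarrow> 'b pair_pre_digraph" where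
  "map_graph f G = \<lparr> pverts = f ` pverts G, parcs = map_prod f f ` parcs G \<rparr>"

definition K2 :: "bool pair_pre_digraph" where
  "K2 = \<lparr> pverts = UNIV, parcs = {(u, v). u \<noteq> v} \<rparr>"

text \<open>
  The iterated product with \<^const>\<open>K2\<close> would live in a type depending on \<open>n\<close>. Vertices are
  therefore renamed along the injections \<open>b \<mapsto> [b]\<close> and \<open>(x, b) \<mapsto> b # x\<close>, so that each
  hypercube is an isomorphic copy on Boolean lists. The value at \<open>0\<close> is the one-vertex graph, by
  convention.
\<close>

fun hypercube :: "nat \<Rightarrow> bool list pair_pre_digraph" where
  "hypercube 0 = \<lparr> pverts = {[]}, parcs = {} \<rparr>"
| "hypercube (Suc 0) = map_graph (\<lambda>b. [b]) K2"
| "hypercube (Suc (Suc n)) =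
    map_graph (\<lambda>(x, b). b # x) (cartesian_product_graph (hypercube (Suc n)) K2)"

definition neighborhood :: "'a pair_pre_digraph \<Rightarrow> 'a \<Rightarrow> 'a set" where
  "neighborhood G u = {v. (u, v) \<in> parcs G}"

definition injective_coloring :: "'a pair_pre_digraph \<Rightarrow> ('a \<Rightarrow> 'c) \<Rightarrow> bool" where
  "injective_coloring G f \<longleftrightarrow>
    \<not> (\<exists>v \<in> pverts G. \<exists>u \<in> neighborhood G v. \<exists>w \<in> neighborhood G v. u \<noteq> w \<and> f u = f w)"

definition color_classes :: "'a pair_pre_digraph \<Rightarrow> ('a \<Rightarrow> 'c) \<Rightarrow> 'a set set" where
  "color_classes G f = {{v \<in> pverts G. f v = c} | c. c \<in> f ` pverts G}"

definition open_packing :: "'a pair_pre_digraph \<Rightarrow> 'a set \<Rightarrow> bool" where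
  "open_packing G B \<longleftrightarrow> B \<subseteq> pverts G \<and>
    (\<forall>u \<in> B. \<forall>v \<in> B. u \<noteq> v \<longrightarrow> neighborhood G u \<inter> neighborhood G v = {})"

definition open_packing_number :: "'a pair_pre_digraph \<Rightarrow> nat" where
  "open_packing_number G = Max (card ` {B. open_packing G B})"

text \<open>Colors are natural numbers, which is no restriction for finite graphs.\<close>

definition perfect_injectively_colorable :: "'a pair_pre_digraph \<Rightarrow> bool" where
  "perfect_injectively_colorable G \<longleftrightarrow> pair_graph G \<and>
    (\<exists>f :: 'a \<Rightarrow> nat. injective_coloring G f \<and>
      (\<forall>B \<in> color_classes G f. open_packing G B \<and> card B = open_packing_number G))"

lemma pverts_hypercube: "pverts (hypercube n) = {x. length x = n}"
proof (induction n rule: hypercube.induct)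
  case 2
  then show ?case by (auto simp: map_graph_def K2_def length_Suc_conv)
next
  case (3 n)
  have "(\<lambda>(x, b). b # x) ` ({x. length x = Suc n} \<times> (UNIV :: bool set)) =
      {x. length x = Suc (Suc n)}"
    by (force simp: length_Suc_conv image_iff)
  with 3 show ?case by (simp add: map_graph_def cartesian_product_graph_def K2_def)
qed auto

lemma parcs_hypercube_Cons:
  "(b # x, c # y) \<in> parcs (hypercube (Suc (Suc n))) \<longleftrightarrow>
    (x, y) \<in> parcs (hypercube (Suc n)) \<and> b = c \<or> x = y \<and> length x = Suc n \<and> b \<noteq> c"
  using pverts_hypercube[of "Suc n"]
  by (force simp: map_graph_def cartesian_product_graph_def K2_def image_iff)

lemma parcs_hypercube:
  "(x, y) \<in> parcs (hypercube n) \<longleftrightarrow>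
    length x = n \<and> length y = n \<and> card {i. i < n \<and> x ! i \<noteq> y ! i} = 1"
proof (induction n arbitrary: x y rule: hypercube.induct)
  case 1
  then show ?case by simp
next
  case 2
  show ?case
  proof (cases "length x = 1 \<and> length y = 1")
    case True
    then obtain b c where eq: "x = [b]" "y = [c]"
      by (auto simp: length_Suc_conv)
    have "{i. i < Suc 0 \<and> x ! i \<noteq> y ! i} = (if b = c then {} else {0})"
      unfolding eq by auto
    then show ?thesis
      unfolding eq by (simp add: map_graph_def K2_def image_iff)
  next
    case False
    then show ?thesis by (auto simp: map_graph_def)
  qed
next
  case (3 n)
  show ?case
  proof (cases "length x = Suc (Suc n) \<and> length y = Suc (Suc n)")
    case True
    then obtain b x' c y' where
      eq: "x = b # x'" "y = c # y'" and len: "length x' = Suc n" "length y' = Suc n"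
      by (auto simp: length_Suc_conv)
    let ?D = "{i. i < Suc n \<and> x' ! i \<noteq> y' ! i}"
    have "i \<in> {i. i < Suc (Suc n) \<and> x ! i \<noteq> y ! i} \<longleftrightarrow>
        i \<in> (if b = c then {} else {0}) \<union> Suc ` ?D" for i
      unfolding eq by (cases i) auto
    then have "{i. i < Suc (Suc n) \<and> x ! i \<noteq> y ! i} = (if b = c then {} else {0}) \<union> Suc ` ?D"
      by blast
    then have card_eq: "card {i. i < Suc (Suc n) \<and> x ! i \<noteq> y ! i} = (if b = c then 0 else 1) + card ?D"
      by (simp add: card_image)
    have card_0: "card ?D = 0 \<longleftrightarrow> x' = y'"
      using len by (auto simp: list_eq_iff_nth_eq)
    have "(x, y) \<in> parcs (hypercube (Suc (Suc n))) \<longleftrightarrow>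
        (x', y') \<in> parcs (hypercube (Suc n)) \<and> b = c \<or> x' = y' \<and> b \<noteq> c"
      unfolding eq parcs_hypercube_Cons using len by blast
    also have "\<dots> \<longleftrightarrow> card ?D = 1 \<and> b = c \<or> card ?D = 0 \<and> b \<noteq> c"
      unfolding 3 card_0 using len by blast
    also have "\<dots> \<longleftrightarrow> card {i. i < Suc (Suc n) \<and> x ! i \<noteq> y ! i} = 1"
      unfolding card_eq by (cases "b = c") simp_all
    finally show ?thesis using True by blast
  next
    case False
    moreover have "parcs (hypercube (Suc (Suc n))) \<subseteq>
        {x. length x = Suc (Suc n)} \<times> {x. length x = Suc (Suc n)}"
      using pverts_hypercube[of "Suc n"] 3
      by (auto simp: map_graph_def cartesian_product_graph_def)
    ultimately show ?thesis by blast
  qed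
qed

lemma pair_graph_hypercube: "pair_graph (hypercube n)"
proof -
  have fin: "finite {x :: bool list. length x = n}"
    using finite_lists_length_eq[of "UNIV :: bool set" n] by simp
  moreover have "parcs (hypercube n) \<subseteq> {x. length x = n} \<times> {x. length x = n}"
    by (auto simp: parcs_hypercube)
  ultimately have "finite (parcs (hypercube n))"
    by (meson finite_SigmaI finite_subset)
  moreover have "(y, x) \<in> parcs (hypercube n)" if "(x, y) \<in> parcs (hypercube n)" for x y
    using that by (simp add: parcs_hypercube eq_commute)
  ultimately show ?thesis
    using fin
    by unfold_locales
      (auto simp: pverts_hypercube symmetric_def parcs_hypercube intro!: symI)
qed

end

theory Submission
  imports Defs
begin

text \<open>
  The neighborhoods of the vertices of an open packing are disjoint, so an open packing \<open>B\<close> of an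
  \<open>n\<close>-regular graph on \<open>N\<close> vertices satisfies \<open>n |B| \<le> N\<close>. If such a graph has an injective coloring
  with \<open>n\<close> colors, then its \<open>n\<close> classes are open packings covering all \<open>N\<close> vertices, which forces
  equality for each of them. For the hypercube with \<open>n = 2 ^ k\<close>, color \<open>x\<close> by the bitwise exclusive
  or of the positions \<open>i < n\<close> with \<open>x ! i\<close>: colors stay below \<open>2 ^ k\<close>, and flipping bit \<open>i\<close> changes
  the color by \<open>i\<close>, so distinct neighbors of a vertex get distinct colors.
\<close>

lemma card_open_packing_le:
  assumes "pair_graph G"
    and regular: "\<And>v. v \<in> pverts G \<Longrightarrow> card (neighborhood G v) = n"
    and B: "open_packing G B"
  shows "n * card B \<le> card (pverts G)"
proof -
  interpret pair_graph G by fact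
  have sub: "neighborhood G u \<subseteq> pverts G" for u
    by (auto simp: neighborhood_def dest: in_arcsD2)
  have BV: "B \<subseteq> pverts G" using B by (simp add: open_packing_def)
  then have finB: "finite B" by (rule finite_subset) simp
  have "card (\<Union>u\<in>B. neighborhood G u) = (\<Sum>u\<in>B. card (neighborhood G u))"
    using B finB by (intro card_UN_disjoint) (auto simp: open_packing_def intro: finite_subset[OF sub])
  also have "\<dots> = n * card B"
    using BV regular by (simp add: subset_iff)
  finally have "n * card B = card (\<Union>u\<in>B. neighborhood G u)" by simp
  also have "\<dots> \<le> card (pverts G)"
    using sub by (intro card_mono) auto
  finally show ?thesis .
qed

text \<open>A common neighbor \<open>w\<close> of two vertices of one class would, by symmetry of
  the arcs, have these two as equally colored distinct neighbors.\<close>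

lemma injective_coloring_open_packing:
  assumes "pair_graph G" and "injective_coloring G f"
  shows "open_packing G {v \<in> pverts G. f v = c}"
proof -
  interpret pair_graph G by fact
  have "False" if "u \<noteq> v" "f u = f v" "(u, w) \<in> parcs G" "(v, w) \<in> parcs G" for u v w
  proof -
    have "u \<in> neighborhood G w" "v \<in> neighborhood G w"
      using that by (auto simp: neighborhood_def intro: arcs_symmetric)
    moreover have "w \<in> pverts G" using that by (auto dest: in_arcsD2)
    ultimately show False
      using assms(2) that unfolding injective_coloring_def by blast
  qed
  then show ?thesis
    by (simp add: open_packing_def neighborhood_def disjoint_iff) blast
qed

lemma regular_perfect_injectively_colorable:
  fixes f :: "'a \<Rightarrow> nat"
  assumes G: "pair_graph G"
    and regular: "\<And>v. v \<in> pverts G \<Longrightarrow> card (neighborhood G v) = n"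
    and f: "injective_coloring G f"
    and colors: "\<And>v. v \<in> pverts G \<Longrightarrow> f v < n"
  shows "perfect_injectively_colorable G"
proof -
  interpret pair_graph G by fact
  define F where "F c = {v \<in> pverts G. f v = c}" for c
  have packing: "open_packing G (F c)" for c
    unfolding F_def by (rule injective_coloring_open_packing[OF G f])
  have le: "n * card B \<le> card (pverts G)" if "open_packing G B" for B
    using card_open_packing_le[OF G regular that] .
  have "pverts G = (\<Union>c<n. F c)"
    using colors by (auto simp: F_def)
  then have "card (pverts G) = card (\<Union>c<n. F c)" by simp
  also have "\<dots> = (\<Sum>c<n. card (F c))"
    by (rule card_UN_disjoint) (auto simp: F_def)
  finally have sum_eq: "card (pverts G) = (\<Sum>c<n. card (F c))" .
  \<comment> \<open>The summands are the slacks in the packing bound. By \<open>le\<close> no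
    subtraction truncates, so the slacks add up to 0 and each of them vanishes.\<close>
  have "(\<Sum>c<n. card (pverts G) - n * card (F c)) = n * card (pverts G) - n * (\<Sum>c<n. card (F c))"
    using le[OF packing] by (subst sum_subtractf_nat) (simp_all add: sum_distrib_left)
  with sum_eq have "(\<Sum>c<n. card (pverts G) - n * card (F c)) = 0" by simp
  then have eq: "n * card (F c) = card (pverts G)" if "c < n" for c
    using that le[OF packing] by (auto simp: le_antisym)
  have "open_packing G B \<and> card B = open_packing_number G" if B: "B \<in> color_classes G f" for B
  proof -
    obtain c where c: "c < n" "B = F c"
      using B colors by (auto simp: color_classes_def F_def)
    have "finite {B. open_packing G B}"
      by (rule finite_subset[of _ "Pow (pverts G)"]) (auto simp: open_packing_def)
    \<comment> \<open>From \<open>c < n\<close> it follows that \<open>n\<close> is positive and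
      cancels in \<open>n * card B' \<le> n * card (F c)\<close>.\<close>
    moreover have "card B' \<le> card B" if "open_packing G B'" for B'
      using le[OF that] eq[OF c(1)] c by (metis mult_le_cancel1 less_nat_zero_code neq0_conv)
    ultimately have "open_packing_number G = card B"
      unfolding open_packing_number_def using packing c by (intro Max_eqI) auto
    then show ?thesis using packing c by simp
  qed
  with G f show ?thesis
    unfolding perfect_injectively_colorable_def by blast
qed

definition flip :: "bool list \<Rightarrow> nat \<Rightarrow> bool list" where
  "flip x i = x[i := \<not> x ! i]"

lemma neighborhood_hypercube:
  assumes "length x = n"
  shows "neighborhood (hypercube n) x = flip x ` {..<n}"
proof (intro set_eqI iffI)
  fix y assume "y \<in> neighborhood (hypercube n) x"
  then have y: "length y = n" and "card {i. i < n \<and> x ! i \<noteq> y ! i} = 1"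
    by (auto simp: neighborhood_def parcs_hypercube)
  then obtain i where i: "{i. i < n \<and> x ! i \<noteq> y ! i} = {i}"
    by (auto simp: card_1_singleton_iff)
  then have "i < n" by blast
  have differ: "x ! j \<noteq> y ! j \<longleftrightarrow> j = i" if "j < n" for j
    using that i by blast
  have "y = flip x i"
  proof (rule nth_equalityI)
    show "y ! j = flip x i ! j" if "j < length y" for j
      using differ[of j] that assms y by (cases "j = i") (auto simp: flip_def)
  qed (simp add: flip_def assms y)
  with \<open>i < n\<close> show "y \<in> flip x ` {..<n}" by simp
next
  fix y assume "y \<in> flip x ` {..<n}"
  then obtain i where i: "i < n" "y = flip x i" by auto
  then have "{j. j < n \<and> x ! j \<noteq> y ! j} = {i}"
    using assms by (auto simp: flip_def nth_list_update)
  then show "y \<in> neighborhood (hypercube n) x"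
    using assms i by (simp add: neighborhood_def parcs_hypercube flip_def)
qed

lemma inj_on_flip: "inj_on (flip x) {..<length x}"
  by (intro inj_onI) (metis flip_def lessThan_iff nth_list_update_eq nth_list_update_neq)

lemma card_neighborhood_hypercube:
  "length x = n \<Longrightarrow> card (neighborhood (hypercube n) x) = n"
  using inj_on_flip[of x] by (simp add: neighborhood_hypercube card_image)

unbundle bit_operations_syntax

text \<open>The offset \<open>m\<close> is the position of the head in the full list. Starting from
  0, this is the syndrome map of a Hamming code with one extra free coordinate, position 0.\<close>

fun xor_positions :: "nat \<Rightarrow> bool list \<Rightarrow> nat" where
  "xor_positions m [] = 0"
| "xor_positions m (b # x) = (if b then m else 0) XOR xor_positions (Suc m) x"

lemma xor_positions_flip:
  "i < length x \<Longrightarrow> xor_positions m (flip x i) = xor_positions m x XOR (m + i)"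
proof (induction x arbitrary: m i)
  case (Cons b x)
  \<comment> \<open>For a flip at the head from true to false: removing \<open>m\<close> from the
    color is XORing it in once more.\<close>
  have cancel: "m XOR (m XOR a) = a" for a
    by (simp flip: xor.assoc)
  show ?case
  proof (cases i)
    case 0
    then show ?thesis by (simp add: flip_def cancel ac_simps)
  next
    case (Suc j)
    then show ?thesis
      using Cons.IH[of j "Suc m"] Cons.prems by (simp add: flip_def ac_simps)
  qed
qed simp

text \<open>Being below \<open>2 ^ k\<close> means being fixed by \<open>take_bit k\<close>, which
  commutes with XOR.\<close>

lemma xor_less_power2: "a < 2 ^ k \<Longrightarrow> b < 2 ^ k \<Longrightarrow> a XOR b < 2 ^ k" for a b :: nat
  by (metis take_bit_nat_eq_self_iff take_bit_xor)

lemma xor_positions_less: "m + length x \<le> 2 ^ k \<Longrightarrow> xor_positions m x < 2 ^ k"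
  by (induction x arbitrary: m) (auto intro!: xor_less_power2)

lemma injective_coloring_hypercube:
  "injective_coloring (hypercube n) (xor_positions 0)"
proof -
  have "i = j" if "a XOR i = a XOR j" for a i j :: nat
    using that by (metis xor.assoc xor_self_eq xor.left_neutral)
  then show ?thesis
    by (auto simp: injective_coloring_def pverts_hypercube neighborhood_hypercube xor_positions_flip)
qed

theorem theorem19:
  fixes k :: nat
  assumes "k \<ge> 1"
  shows "perfect_injectively_colorable (hypercube (2 ^ k))"
proof (rule regular_perfect_injectively_colorable)
  show "pair_graph (hypercube (2 ^ k))" by (rule pair_graph_hypercube)
  show "injective_coloring (hypercube (2 ^ k)) (xor_positions 0)"
    by (rule injective_coloring_hypercube)
next
  fix x assume "x \<in> pverts (hypercube (2 ^ k))"
  then have x: "length x = 2 ^ k" by (simp add: pverts_hypercube)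
  show "card (neighborhood (hypercube (2 ^ k)) x) = 2 ^ k"
    using x by (rule card_neighborhood_hypercube)
  \<comment> \<open>Here the dimension being a power of two matters: XORs of positions stay below
    the degree.\<close>
  show "xor_positions 0 x < 2 ^ k"
    using x by (intro xor_positions_less) simp
qed

end
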